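(* Let $C:H_1\to H_2$ be a nonzero bounded linear mapping between real Hilbert spaces, with adjoint $C^T:H_2\to H_1$, and let $\alpha\in\mathbb{R}$. If $\alpha\in\left[0,\frac{2}{\|C\|^2}\right]$, then $\|I-\alpha CC^T\|\le1$. In addition, if $H_1=\mathbb{R}^n$ and $H_2=\mathbb{R}^m$ (i.e. $C$ can be represented as a matrix), then the two conditions $\alpha\in\left[0,\frac{2}{\|C\|^2}\right]$ and $\|I-\alpha CC^T\|\le1$ are equivalent.
   Context: $\|\cdot\|$ denotes the operator norm induced by the Hilbert space norms (Euclidean norms on $\mathbb{R}^n$ and $\mathbb{R}^m$), and $I$ is the identity of $H_2$. *)

theory Defs
  imports "HOL-Analysis.Analysis"
begin

end

theory Submission
  imports Defs
begin

text \<open>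
  Write \<open>T\<close> for the adjoint of \<open>C\<close>. Everything rests on the identity
  \<open>C x \<bullet> y = x \<bullet> T y\<close>, which needs the adjoint to exist. Existence is the Riesz representation
  theorem for the functionals \<open>x \<mapsto> C x \<bullet> y\<close>; it is obtained here by minimising the quadratic
  functional \<open>\<parallel>x\<parallel>\<^sup>2 - 2 f x\<close> (\<open>riesz_representation\<close>).

  If \<open>0 \<le> \<alpha> \<le> 2 / \<parallel>C\<parallel>\<^sup>2\<close>, expanding the square gives
  \<open>\<parallel>y - \<alpha> C T y\<parallel>\<^sup>2 = \<parallel>y\<parallel>\<^sup>2 - 2 \<alpha> \<parallel>T y\<parallel>\<^sup>2 + \<alpha>\<^sup>2 \<parallel>C T y\<parallel>\<^sup>2
    \<le> \<parallel>y\<parallel>\<^sup>2 - \<alpha> (2 - \<alpha> \<parallel>C\<parallel>\<^sup>2) \<parallel>T y\<parallel>\<^sup>2 \<le> \<parallel>y\<parallel>\<^sup>2\<close>.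

  The converse is true in every Hilbert space, by an argument without compactness.
  Suppose \<open>\<parallel>I - \<alpha> C T\<parallel> \<le> 1\<close>. Pairing \<open>(I - \<alpha> C T) y\<close> with \<open>y\<close>
  gives \<open>\<alpha> \<parallel>T y\<parallel>\<^sup>2 \<ge> 0\<close>, hence \<open>\<alpha> \<ge> 0\<close> because \<open>T \<noteq> 0\<close>. As \<open>\<alpha> C T\<close> is the difference of \<open>I\<close>
  and \<open>I - \<alpha> C T\<close>, its norm is at most \<open>2\<close>; since \<open>\<parallel>C T\<parallel> = \<parallel>C\<parallel>\<^sup>2\<close>, this says
  \<open>\<alpha> \<parallel>C\<parallel>\<^sup>2 \<le> 2\<close>.
\<close>

section \<open>Riesz representation\<close>

text \<open>
  The functional \<open>J x = \<parallel>x\<parallel>\<^sup>2 - 2 f x\<close> is bounded below because \<open>f\<close> grows only linearly, and the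
  parallelogram law turns a minimising sequence into a Cauchy sequence. At the minimiser \<open>z\<close> the
  derivative of \<open>J\<close> vanishes in each direction \<open>h\<close>, which reads \<open>z \<bullet> h = f h\<close>.
\<close>

theorem riesz_representation:
  fixes f :: "'a::{real_inner, complete_space} \<Rightarrow> real"
  assumes "bounded_linear f"
  shows "\<exists>z. \<forall>x. f x = x \<bullet> z"
proof -
  interpret f: bounded_linear f by fact
  obtain K where K: "\<And>x. \<bar>f x\<bar> \<le> norm x * K"
    using f.bounded by auto
  define J where "J x = (norm x)\<^sup>2 - 2 * f x" for x
  have "- K\<^sup>2 \<le> J x" for x
  proof -
    have "0 \<le> (norm x - K)\<^sup>2" by simp
    also have "(norm x - K)\<^sup>2 = (norm x)\<^sup>2 - 2 * (norm x * K) + K\<^sup>2"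
      by (simp add: power2_diff)
    finally show ?thesis using K[of x] by (simp add: J_def)
  qed
  then have bdd: "bdd_below (range J)" by (rule bdd_belowI2)
  define m where "m = Inf (range J)"
  have m_le: "m \<le> J x" for x
    unfolding m_def by (rule cInf_lower) (use bdd in auto)
  have "\<exists>x. J x < m + inverse (real (Suc n))" for n
  proof -
    have "Inf (range J) < m + inverse (real (Suc n))" by (simp add: m_def)
    from cInf_lessD[OF _ this] show ?thesis by auto
  qed
  then obtain X where X: "\<And>n. J (X n) < m + inverse (real (Suc n))"
    using choice[of "\<lambda>n x. J x < m + inverse (real (Suc n))"] by blast
  have parallelogram: "J x + J y - 2 * J ((1/2) *\<^sub>R (x + y)) = (norm (x - y))\<^sup>2 / 2" for x y
    unfolding J_def f.scaleR f.add power2_norm_eq_inner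
    by (simp add: inner_commute[of y x] algebra_simps)
  have near: "(norm (x - y))\<^sup>2 < 4 * e" if "J x < m + e" "J y < m + e" for x y e
    using parallelogram[of x y] m_le[of "(1/2) *\<^sub>R (x + y)"] that by linarith
  have "Cauchy X"
  proof (rule metric_CauchyI)
    fix e :: real assume e: "0 < e"
    then obtain N where N: "inverse (real (Suc N)) < e\<^sup>2 / 4"
      using reals_Archimedean[of "e\<^sup>2 / 4"] by auto
    have "J (X n) < m + e\<^sup>2 / 4" if "N \<le> n" for n
    proof -
      have "inverse (real (Suc n)) \<le> inverse (real (Suc N))"
        using that by (intro le_imp_inverse_le) auto
      with X[of n] N show ?thesis by linarith
    qed
    then have "(norm (X n - X k))\<^sup>2 < e\<^sup>2" if "N \<le> n" "N \<le> k" for n k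
      using near[of "X n" "e\<^sup>2 / 4" "X k"] that by simp
    then have "dist (X n) (X k) < e" if "N \<le> n" "N \<le> k" for n k
      using that e by (metis dist_norm less_imp_le power_less_imp_less_base)
    then show "\<exists>N. \<forall>n\<ge>N. \<forall>k\<ge>N. dist (X n) (X k) < e" by blast
  qed
  then obtain z where z: "X \<longlonglongrightarrow> z" by (auto simp: Cauchy_convergent_iff convergent_def)
  have "(\<lambda>n. J (X n)) \<longlonglongrightarrow> J z"
    unfolding J_def by (intro tendsto_intros f.tendsto z)
  moreover have "(\<lambda>n. m + inverse (real (Suc n))) \<longlonglongrightarrow> m + 0"
    by (intro tendsto_intros LIMSEQ_inverse_real_of_nat)
  ultimately have "J z \<le> m + 0"
    by (rule LIMSEQ_le) (use X in \<open>auto intro: less_imp_le\<close>)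
  then have min: "J z \<le> J x" for x using m_le[of x] by simp
  have "f h = h \<bullet> z" for h
  proof (cases "h = 0")
    case False
    define d where "d = z \<bullet> h - f h"
    define t where "t = - d / (norm h)\<^sup>2"
    \<comment> \<open>This \<open>t\<close> minimises the quadratic polynomial \<open>J (z + t h)\<close>.\<close>
    have "J (z + t *\<^sub>R h) = J z + 2 * t * d + t\<^sup>2 * (norm h)\<^sup>2"
      unfolding J_def d_def f.add f.scaleR power2_norm_eq_inner
      by (simp add: inner_commute power2_eq_square algebra_simps)
    also have "\<dots> = J z - d\<^sup>2 / (norm h)\<^sup>2"
      using False by (simp add: t_def power2_eq_square field_simps)
    finally have "d\<^sup>2 / (norm h)\<^sup>2 \<le> 0" using min[of "z + t *\<^sub>R h"] by linarith
    then have "d = 0" using False by (simp add: divide_le_0_iff)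
    then show ?thesis by (simp add: d_def inner_commute)
  qed simp
  then show ?thesis by blast
qed

section \<open>The adjoint of a bounded operator\<close>

text \<open>
  The constant \<open>adjoint\<close> is an arbitrary choice of an operator with this property; the Riesz
  vectors of the functionals \<open>x \<mapsto> C x \<bullet> y\<close> show that there is one to choose.
\<close>

lemma inner_adjoint:
  fixes C :: "'a::{real_inner, complete_space} \<Rightarrow> 'b::real_inner"
  assumes "bounded_linear C"
  shows "C x \<bullet> y = x \<bullet> adjoint C y"
proof -
  have "\<exists>z. \<forall>x. C x \<bullet> y = x \<bullet> z" for y
    by (intro riesz_representation bounded_linear_inner_left_comp assms)
  then have "\<exists>g. \<forall>x y. C x \<bullet> y = x \<bullet> g y" by metis
  then have "\<forall>x y. C x \<bullet> y = x \<bullet> adjoint C y"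
    unfolding adjoint_def by (rule someI_ex)
  then show ?thesis by blast
qed

lemma norm_adjoint_power2:
  fixes C :: "'a::{real_inner, complete_space} \<Rightarrow> 'b::real_inner"
  assumes "bounded_linear C"
  shows "(norm (adjoint C y))\<^sup>2 = C (adjoint C y) \<bullet> y"
  by (simp only: power2_norm_eq_inner inner_adjoint[OF assms])

text \<open>
  A self-improving estimate: \<open>\<parallel>T y\<parallel>\<^sup>2 = C T y \<bullet> y \<le> \<parallel>C\<parallel> \<parallel>T y\<parallel> \<parallel>y\<parallel>\<close>, and one factor \<open>\<parallel>T y\<parallel>\<close> cancels.
\<close>

lemma norm_adjoint_le:
  fixes C :: "'a::{real_inner, complete_space} \<Rightarrow> 'b::real_inner"
  assumes "bounded_linear C"
  shows "norm (adjoint C y) \<le> onorm C * norm y"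
proof (cases "adjoint C y = 0")
  case True
  then show ?thesis by (simp add: onorm_pos_le[OF assms])
next
  case False
  have "norm (adjoint C y) * norm (adjoint C y) \<le> norm (C (adjoint C y)) * norm y"
    by (simp only: power2_eq_square[symmetric] norm_adjoint_power2[OF assms] norm_cauchy_schwarz)
  also have "\<dots> \<le> (onorm C * norm (adjoint C y)) * norm y"
    by (intro mult_right_mono onorm[OF assms]) simp
  finally have "norm (adjoint C y) * norm (adjoint C y) \<le> norm (adjoint C y) * (onorm C * norm y)"
    by (simp add: mult_ac)
  then show ?thesis using False by simp
qed

lemma bounded_linear_adjoint:
  fixes C :: "'a::{real_inner, complete_space} \<Rightarrow> 'b::real_inner"
  assumes "bounded_linear C"
  shows "bounded_linear (adjoint C)"
proof (rule bounded_linear_intro)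
  show "adjoint C (x + y) = adjoint C x + adjoint C y" for x y
    by (rule vector_eq_ldot[THEN iffD1])
      (simp add: inner_add_right flip: inner_adjoint[OF assms])
  show "adjoint C (r *\<^sub>R x) = r *\<^sub>R adjoint C x" for r x
    by (rule vector_eq_ldot[THEN iffD1])
      (simp flip: inner_adjoint[OF assms])
  show "norm (adjoint C y) \<le> norm y * onorm C" for y
    using norm_adjoint_le[OF assms] by (simp add: mult.commute)
qed

lemma adjoint_eq_0_imp_eq_0:
  fixes C :: "'a::{real_inner, complete_space} \<Rightarrow> 'b::real_inner"
  assumes "bounded_linear C" "\<And>y. adjoint C y = 0"
  shows "C = (\<lambda>x. 0)"
proof
  fix x
  have "C x \<bullet> C x = 0" by (simp only: inner_adjoint[OF assms(1)] assms(2) inner_zero_right)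
  then show "C x = 0" by simp
qed

text \<open>
  This is the inequality \<open>\<parallel>C\<parallel>\<^sup>2 \<le> \<parallel>C T\<parallel>\<close> with an explicit bound in place of \<open>\<parallel>C T\<parallel>\<close>. It passes
  through \<open>T\<close>: the bound on \<open>C T\<close> gives \<open>\<parallel>T y\<parallel>\<^sup>2 \<le> B \<parallel>y\<parallel>\<^sup>2\<close>, and for \<open>y = C x\<close> the identity
  \<open>\<parallel>C x\<parallel>\<^sup>2 = x \<bullet> T C x\<close> transfers this to \<open>C\<close>.
\<close>

lemma onorm_power2_le_if_norm_comp_adjoint_le:
  fixes C :: "'a::{real_inner, complete_space} \<Rightarrow> 'b::real_inner"
  assumes C: "bounded_linear C"
    and B: "\<And>y. norm (C (adjoint C y)) \<le> B * norm y" "0 \<le> B"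
  shows "(onorm C)\<^sup>2 \<le> B"
proof -
  have adj: "norm (adjoint C y) \<le> sqrt B * norm y" for y
  proof (rule power2_le_imp_le)
    have "(norm (adjoint C y))\<^sup>2 \<le> norm (C (adjoint C y)) * norm y"
      by (simp only: norm_adjoint_power2[OF C] norm_cauchy_schwarz)
    also have "\<dots> \<le> (B * norm y) * norm y"
      by (intro mult_right_mono B) simp
    finally show "(norm (adjoint C y))\<^sup>2 \<le> (sqrt B * norm y)\<^sup>2"
      using B(2) by (simp add: power_mult_distrib) (simp add: power2_eq_square mult.assoc)
  qed (use B in simp)
  have "norm (C x) \<le> sqrt B * norm x" for x
  proof (cases "C x = 0")
    case False
    have "norm (C x) * norm (C x) = x \<bullet> adjoint C (C x)"
      by (simp only: inner_adjoint[OF C, symmetric] power2_norm_eq_inner[symmetric] power2_eq_square)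
    also have "\<dots> \<le> norm x * norm (adjoint C (C x))"
      by (rule norm_cauchy_schwarz)
    also have "\<dots> \<le> norm x * (sqrt B * norm (C x))"
      by (intro mult_left_mono adj) simp
    finally have "norm (C x) * norm (C x) \<le> norm (C x) * (sqrt B * norm x)"
      by (simp add: mult_ac)
    then show ?thesis using False by simp
  qed (use B in simp)
  then have "onorm C \<le> sqrt B" by (intro onorm_bound) (use B in auto)
  then have "(onorm C)\<^sup>2 \<le> (sqrt B)\<^sup>2"
    by (rule power_mono) (rule onorm_pos_le[OF C])
  then show ?thesis using B by simp
qed

section \<open>Nonexpansiveness of the residual operator\<close>

lemma onorm_id_minus_le_1_if:
  fixes C :: "'a::{real_inner, complete_space} \<Rightarrow> 'b::real_inner"
  assumes C: "bounded_linear C" and \<alpha>: "0 \<le> \<alpha>" "\<alpha> * (onorm C)\<^sup>2 \<le> 2"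
  shows "onorm (\<lambda>y. y - \<alpha> *\<^sub>R C (adjoint C y)) \<le> 1"
proof (rule onorm_bound)
  fix y
  let ?w = "adjoint C y"
  have "norm (C ?w) \<le> onorm C * norm ?w" by (rule onorm[OF C])
  then have "(norm (C ?w))\<^sup>2 \<le> (onorm C)\<^sup>2 * (norm ?w)\<^sup>2"
    unfolding power_mult_distrib[symmetric] by (rule power_mono) simp
  then have "\<alpha> * (norm (C ?w))\<^sup>2 \<le> (\<alpha> * (onorm C)\<^sup>2) * (norm ?w)\<^sup>2"
    using \<alpha>(1) by (simp add: mult_left_mono mult.assoc)
  also have "\<dots> \<le> 2 * (norm ?w)\<^sup>2"
    by (intro mult_right_mono \<alpha>) simp
  finally have "\<alpha> * (\<alpha> * (norm (C ?w))\<^sup>2) \<le> \<alpha> * (2 * (norm ?w)\<^sup>2)"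
    using \<alpha>(1) by (rule mult_left_mono)
  moreover have "(norm (y - \<alpha> *\<^sub>R C ?w))\<^sup>2
      = (norm y)\<^sup>2 - \<alpha> * (2 * (norm ?w)\<^sup>2) + \<alpha> * (\<alpha> * (norm (C ?w))\<^sup>2)"
    unfolding norm_adjoint_power2[OF C]
    by (simp add: power2_norm_eq_inner inner_commute algebra_simps)
  ultimately have "(norm (y - \<alpha> *\<^sub>R C ?w))\<^sup>2 \<le> (norm y)\<^sup>2" by linarith
  then show "norm (y - \<alpha> *\<^sub>R C ?w) \<le> 1 * norm y"
    by (simp add: power_mono_iff)
qed simp

text \<open>
  For \<open>\<alpha> > 0\<close> the triangle inequality alone gives \<open>\<alpha> \<parallel>C T y\<parallel> \<le> 2 \<parallel>y\<parallel>\<close>, and \<open>\<parallel>C\<parallel>\<^sup>2 \<le> \<parallel>C T\<parallel>\<close>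
  makes this the sharp bound on \<open>\<alpha>\<close>.
\<close>

lemma onorm_id_minus_le_1_imp:
  fixes C :: "'a::{real_inner, complete_space} \<Rightarrow> 'b::real_inner"
  assumes C: "bounded_linear C" "C \<noteq> (\<lambda>x. 0)"
    and le: "onorm (\<lambda>y. y - \<alpha> *\<^sub>R C (adjoint C y)) \<le> 1"
  shows "0 \<le> \<alpha>" "\<alpha> * (onorm C)\<^sup>2 \<le> 2"
proof -
  have "bounded_linear (\<lambda>y. y - \<alpha> *\<^sub>R C (adjoint C y))"
    by (intro bounded_linear_sub bounded_linear_ident bounded_linear_const_scaleR
        bounded_linear_compose[OF C(1)] bounded_linear_adjoint C(1))
  then have contr: "norm (y - \<alpha> *\<^sub>R C (adjoint C y)) \<le> norm y" for y
    using onorm[of "\<lambda>y. y - \<alpha> *\<^sub>R C (adjoint C y)" y] le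
    by (meson mult_left_le_one_le norm_ge_zero onorm_pos_le order_trans)
  obtain y where y: "adjoint C y \<noteq> 0"
    using adjoint_eq_0_imp_eq_0[OF C(1)] C(2) by blast
  have "(norm y)\<^sup>2 - \<alpha> * (norm (adjoint C y))\<^sup>2 = (y - \<alpha> *\<^sub>R C (adjoint C y)) \<bullet> y"
    unfolding norm_adjoint_power2[OF C(1)] by (simp add: power2_norm_eq_inner inner_diff_left)
  also have "\<dots> \<le> norm (y - \<alpha> *\<^sub>R C (adjoint C y)) * norm y"
    by (rule norm_cauchy_schwarz)
  also have "\<dots> \<le> norm y * norm y"
    by (intro mult_right_mono contr) simp
  finally have "0 \<le> \<alpha> * (norm (adjoint C y))\<^sup>2" by (simp add: power2_eq_square)
  then show \<alpha>: "0 \<le> \<alpha>" using y by (simp add: zero_le_mult_iff)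
  show "\<alpha> * (onorm C)\<^sup>2 \<le> 2"
  proof (cases "\<alpha> = 0")
    case False
    have "norm (C (adjoint C y)) \<le> 2 / \<alpha> * norm y" for y
    proof -
      have "\<alpha> * norm (C (adjoint C y)) = norm (y - (y - \<alpha> *\<^sub>R C (adjoint C y)))"
        using \<alpha> by simp
      also have "\<dots> \<le> norm y + norm (y - \<alpha> *\<^sub>R C (adjoint C y))"
        by (rule norm_triangle_ineq4)
      also have "\<dots> \<le> 2 * norm y" using contr[of y] by simp
      finally show ?thesis using False \<alpha> by (simp add: field_simps)
    qed
    then have "(onorm C)\<^sup>2 \<le> 2 / \<alpha>"
      using \<alpha> by (intro onorm_power2_le_if_norm_comp_adjoint_le[OF C(1)]) auto
    then show ?thesis using False \<alpha> by (simp add: field_simps)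
  qed simp
qed

theorem onorm_id_minus_le_1_iff:
  fixes C :: "'a::{real_inner, complete_space} \<Rightarrow> 'b::real_inner"
  assumes "bounded_linear C" "C \<noteq> (\<lambda>x. 0)"
  shows "\<alpha> \<in> {0 .. 2 / (onorm C)\<^sup>2} \<longleftrightarrow> onorm (\<lambda>y. y - \<alpha> *\<^sub>R C (adjoint C y)) \<le> 1"
proof -
  have "0 < onorm C"
    using assms by (auto simp: onorm_pos_lt)
  then have "\<alpha> \<in> {0 .. 2 / (onorm C)\<^sup>2} \<longleftrightarrow> 0 \<le> \<alpha> \<and> \<alpha> * (onorm C)\<^sup>2 \<le> 2"
    by (simp add: pos_le_divide_eq)
  then show ?thesis
    using onorm_id_minus_le_1_if[OF assms(1)] onorm_id_minus_le_1_imp[OF assms] by blast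
qed

theorem proposition4:
  shows "(\<forall>(C :: 'h1::{real_inner, complete_space} \<Rightarrow> 'h2::{real_inner, complete_space}) (\<alpha> :: real).
            bounded_linear C \<and> C \<noteq> (\<lambda>x. 0) \<longrightarrow>
            \<alpha> \<in> {0 .. 2 / (onorm C)\<^sup>2} \<longrightarrow>
            onorm (\<lambda>y. y - \<alpha> *\<^sub>R C (adjoint C y)) \<le> 1)
       \<and> (\<forall>(C :: real ^ 'n \<Rightarrow> real ^ 'm) (\<alpha> :: real).
            bounded_linear C \<and> C \<noteq> (\<lambda>x. 0) \<longrightarrow>
            (\<alpha> \<in> {0 .. 2 / (onorm C)\<^sup>2} \<longleftrightarrow>
             onorm (\<lambda>y. y - \<alpha> *\<^sub>R C (adjoint C y)) \<le> 1))"
  by (intro conjI allI impI; elim conjE)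
    (rule onorm_id_minus_le_1_iff[THEN iffD1], assumption+, rule onorm_id_minus_le_1_iff)

end
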